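(* For every integer $n\ge 1$, the number of weakly increasing frustrated parking functions of length $n$ is $2^{n-1}$.
   Context: Let $n\ge 1$ and $[n]=\{1,2,\dots,n\}$. There are $n$ cars and $n$ parking spots numbered $1,\dots,n$, all initially empty. Given a preference sequence $(a_1,\dots,a_n)\in[n]^n$, cars $1,2,\dots,n$ enter in this order. If spot $a_i$ is unoccupied when car $i$ enters, car $i$ parks in spot $a_i$. Otherwise car $i$ parks in the largest-numbered unoccupied spot greater than $a_i$, if such a spot exists; if none exists, car $i$ cannot park. The sequence $(a_1,\dots,a_n)$ is a frustrated parking function of length $n$ if all $n$ cars can park under this rule. It is weakly increasing if $a_1\le a_2\le\cdots\le a_n$. *)

theory Defs
  imports Main
begin

(* Spots are the numbers 1..n; occ is the set of currently occupied spots.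
   None means that a car with preference a cannot park. *)
definition parking_spot :: "nat \<Rightarrow> nat set \<Rightarrow> nat \<Rightarrow> nat option" where
  "parking_spot n occ a =
    (if a \<notin> occ then Some a
     else let free = {s \<in> {1..n}. a < s \<and> s \<notin> occ}
          in if free = {} then None else Some (Max free))"

(* The remaining cars, with the given preferences, enter in list order. The process
   stops with False at the first car that cannot park. *)
fun all_park :: "nat \<Rightarrow> nat set \<Rightarrow> nat list \<Rightarrow> bool" where
  "all_park n occ [] \<longleftrightarrow> True"
| "all_park n occ (a # as) \<longleftrightarrow>
    (case parking_spot n occ a of
       None \<Rightarrow> False
     | Some s \<Rightarrow> all_park n (insert s occ) as)"

definition frustrated_parking_function :: "nat \<Rightarrow> nat list \<Rightarrow> bool" where
  "frustrated_parking_function n as \<longleftrightarrow>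
    length as = n \<and> set as \<subseteq> {1..n} \<and> all_park n {} as"

end

theory Submission
  imports Defs
begin

text \<open>
  In a weakly increasing frustrated parking function, every car fills one end of a single
  block of free spots.
  Suppose that the free spots are \<open>k + 1, \<dots>, k + r\<close>, that \<open>r\<close> cars are still to come, and that
  the last preference was \<open>k\<close>. If the next preference exceeded \<open>k + 1\<close>, then so would all later
  ones; as a car never parks below its preference, spot \<open>k + 1\<close> would stay empty, and \<open>r\<close> cars
  do not fit into \<open>r - 1\<close> spots (\<open>all_park_length_le\<close>). Hence the next preference is \<open>k\<close> or
  \<open>k + 1\<close>. Preference \<open>k\<close> hits an occupied spot and sends the car to the top free spot \<open>k + r\<close>;
  preference \<open>k + 1\<close> takes the bottom free spot. Either way the free spots again form
  a block whose lower neighbour is the last preference, now with \<open>r - 1\<close> spots. So the remaining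
  \<open>r\<close> preferences can be chosen in \<open>2 ^ r\<close> ways (\<open>card_sorted_completions\<close>). The first
  preference has to be 1 by the same counting argument, and this leads to the situation above with
  \<open>k = 1\<close> and \<open>r = n - 1\<close>.
\<close>

lemma parking_spot_SomeD:
  assumes "parking_spot n occ a = Some s" "a \<in> {1..n}"
  shows "s \<in> {a..n}" "s \<notin> occ"
proof -
  define free where "free = {s \<in> {1..n}. a < s \<and> s \<notin> occ}"
  have "Max free \<in> free" if "free \<noteq> {}"
    using that by (intro Max_in) (auto simp: free_def)
  then show "s \<in> {a..n}" "s \<notin> occ"
    using assms unfolding parking_spot_def Let_def free_def[symmetric]
    by (auto split: if_splits) (simp_all add: free_def)
qed

text \<open>Cars never park below their preference, so the cars that prefer spots above \<open>b\<close> compete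
  for the free spots above \<open>b\<close> only.\<close>

lemma all_park_length_le:
  assumes "all_park n occ as" "set as \<subseteq> {b<..n}"
  shows "length as \<le> card ({b<..n} - occ)"
  using assms
proof (induction as arbitrary: occ)
  case (Cons a as)
  then obtain s where s: "parking_spot n occ a = Some s" "all_park n (insert s occ) as"
    by (auto split: option.splits)
  with Cons.prems have "s \<in> {b<..n} - occ"
    using parking_spot_SomeD[OF s(1)] by auto
  moreover have "{b<..n} - insert s occ = ({b<..n} - occ) - {s}"
    by auto
  ultimately have "card ({b<..n} - occ) = Suc (card ({b<..n} - insert s occ))"
    using card.remove[of "{b<..n} - occ" s] by (simp only: finite_Diff finite_greaterThanAtMost)
  moreover have "length as \<le> card ({b<..n} - insert s occ)"
    using Cons s(2) by simp
  ultimately show ?case by simp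
qed simp

text \<open>The ways to continue when the free spots are \<open>k + 1, \<dots>, k + r\<close> and the last preference
  was \<open>k\<close>. That the last preference is the lower neighbour of the free block makes \<open>k\<close>
  the only occupied spot that the next car can prefer and still park: a smaller preference breaks
  the order, and above the block there is no free spot left.\<close>

definition sorted_completions :: "nat \<Rightarrow> nat \<Rightarrow> nat \<Rightarrow> nat list set" where
  "sorted_completions n k r =
    {as. length as = r \<and> set as \<subseteq> {1..n} \<and> sorted (k # as) \<and>
         all_park n ({1..k} \<union> {k + r<..n}) as}"

text \<open>If the smallest remaining preference exceeds \<open>k + 1\<close>, nobody takes spot \<open>k + 1\<close>, and
  \<open>r + 1\<close> cars are left with \<open>r\<close> free spots. For \<open>k = 0\<close> and \<open>r = n - 1\<close> the street is empty, so
  the lemma also bounds the first preference of all.\<close>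

lemma head_le_Suc:
  assumes "all_park n ({1..k} \<union> {k + Suc r<..n}) (a # as)" "length as = r"
    and "set (a # as) \<subseteq> {1..n}" "sorted (a # as)" "k + Suc r \<le> n"
  shows "a \<le> Suc k"
proof (rule ccontr)
  assume "\<not> a \<le> Suc k"
  with assms have "set (a # as) \<subseteq> {Suc k<..n}"
    by fastforce
  from all_park_length_le[OF assms(1) this]
  have "Suc r \<le> card ({Suc k<..n} - ({1..k} \<union> {k + Suc r<..n}))"
    using assms(2) by simp
  also have "{Suc k<..n} - ({1..k} \<union> {k + Suc r<..n}) = {Suc k<..k + Suc r}"
    using assms(5) by auto
  finally show False by simp
qed

lemma parking_spot_repeat:
  assumes "1 \<le> k" "k + Suc r \<le> n"
  shows "parking_spot n ({1..k} \<union> {k + Suc r<..n}) k = Some (k + Suc r)"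
proof -
  have "{s \<in> {1..n}. k < s \<and> s \<notin> {1..k} \<union> {k + Suc r<..n}} = {k<..k + Suc r}"
    using assms by auto
  moreover have "Max {k<..k + Suc r} = k + Suc r"
    by (rule Max_eqI) auto
  ultimately show ?thesis
    using assms by (simp add: parking_spot_def Let_def)
qed

lemma parking_spot_next:
  "parking_spot n ({1..k} \<union> {k + Suc r<..n}) (Suc k) = Some (Suc k)"
  by (simp add: parking_spot_def)

lemma sorted_completions_Suc:
  assumes "1 \<le> k" "k + Suc r \<le> n"
  shows "sorted_completions n k (Suc r) =
    Cons k ` sorted_completions n k r \<union> Cons (Suc k) ` sorted_completions n (Suc k) r"
proof -
  let ?occ = "{1..k} \<union> {k + Suc r<..n}"
  have low: "insert (Suc k) ?occ = {1..Suc k} \<union> {Suc k + r<..n}"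
    and high: "insert (k + Suc r) ?occ = {1..k} \<union> {k + r<..n}"
    using assms by auto
  have park_repeat: "all_park n ?occ (k # as) \<longleftrightarrow> all_park n ({1..k} \<union> {k + r<..n}) as"
    and park_next: "all_park n ?occ (Suc k # as) \<longleftrightarrow>
      all_park n ({1..Suc k} \<union> {Suc k + r<..n}) as" for as
    by (simp_all only: all_park.simps parking_spot_repeat[OF assms] parking_spot_next
        option.case low high)
  have repeat: "k # as \<in> sorted_completions n k (Suc r) \<longleftrightarrow> as \<in> sorted_completions n k r" for as
    unfolding sorted_completions_def mem_Collect_eq park_repeat using assms by auto
  have advance: "Suc k # as \<in> sorted_completions n k (Suc r) \<longleftrightarrow>
      as \<in> sorted_completions n (Suc k) r" for as
    unfolding sorted_completions_def mem_Collect_eq park_next using assms by auto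
  have "\<exists>as. xs = k # as \<or> xs = Suc k # as" if xs: "xs \<in> sorted_completions n k (Suc r)" for xs
  proof -
    obtain a as where "xs = a # as"
      using xs by (cases xs) (auto simp: sorted_completions_def)
    moreover have "k \<le> a" "a \<le> Suc k"
      using xs assms head_le_Suc[of n k r a as]
      unfolding sorted_completions_def \<open>xs = a # as\<close> by (simp_all del: all_park.simps)
    ultimately show ?thesis
      by (auto simp: le_Suc_eq)
  qed
  then show ?thesis
    using repeat advance by blast
qed

lemma card_sorted_completions:
  assumes "1 \<le> k" "k + r \<le> n"
  shows "finite (sorted_completions n k r) \<and> card (sorted_completions n k r) = 2 ^ r"
  using assms
proof (induction r arbitrary: k)
  case 0
  have "sorted_completions n k 0 = {[]}"
    by (auto simp: sorted_completions_def)
  then show ?case by simp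
next
  case (Suc r)
  let ?A = "sorted_completions n k r" and ?B = "sorted_completions n (Suc k) r"
  have A: "finite ?A" "card ?A = 2 ^ r" and B: "finite ?B" "card ?B = 2 ^ r"
    using Suc.IH[of k] Suc.IH[of "Suc k"] Suc.prems by auto
  have "card (Cons k ` ?A \<union> Cons (Suc k) ` ?B) = card (Cons k ` ?A) + card (Cons (Suc k) ` ?B)"
    using A B by (intro card_Un_disjoint) auto
  then show ?case
    using A B sorted_completions_Suc[of k r n] Suc.prems by (simp add: card_image)
qed

lemma frustrated_sorted_eq:
  assumes "n \<ge> 1"
  shows "{as. frustrated_parking_function n as \<and> sorted as} =
    Cons 1 ` sorted_completions n 1 (n - 1)"
proof -
  have tail: "frustrated_parking_function n (1 # as) \<and> sorted (1 # as) \<longleftrightarrow>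
      as \<in> sorted_completions n 1 (n - 1)" for as
    using assms by (auto simp: frustrated_parking_function_def sorted_completions_def
        parking_spot_def)
  have "\<exists>as. xs = 1 # as" if xs: "frustrated_parking_function n xs" "sorted xs" for xs
  proof -
    obtain a as where eq: "xs = a # as"
      using xs assms by (cases xs) (auto simp: frustrated_parking_function_def)
    have "a \<le> Suc 0"
      using xs assms head_le_Suc[of n 0 "n - 1" a as]
      by (auto simp: frustrated_parking_function_def eq simp del: all_park.simps)
    moreover have "1 \<le> a"
      using xs by (auto simp: frustrated_parking_function_def eq)
    ultimately show ?thesis
      by (simp add: eq)
  qed
  with tail show ?thesis by blast
qed

theorem corollary2p4:
  fixes n :: nat
  assumes "n \<ge> 1"
  shows "card {as. frustrated_parking_function n as \<and> sorted as} = 2 ^ (n - 1)"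
  using assms card_sorted_completions[of 1 "n - 1" n]
  by (simp add: frustrated_sorted_eq card_image)

end
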